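(* Let $n\ge 1$ and let $\pi\in S_n$ avoid the pattern $132$ and satisfy $|\pi_{i+1}-\pi_i|\le 2$ for all $1\le i<n$. Then the maximum element $n$ can occur only in positions $\{1,2,n\}$; that is, if $\pi_k=n$ then $k\in\{1,2,n\}$.
   Context: $S_n$ is the set of permutations of $\{1,\dots,n\}$ written in one-line notation. A permutation $\pi\in S_n$ avoids $132$ if there are no indices $i<j<k$ with $\pi_i<\pi_k<\pi_j$. *)

theory Defs
  imports "HOL-Combinatorics.Permutations"
begin

text \<open>
  An element of the symmetric group on \<open>{1..n}\<close> is a function \<open>p :: nat \<Rightarrow> nat\<close> with
  \<open>p permutes {1..n}\<close>; its one-line notation is \<open>p 1, p 2, \<dots>, p n\<close>. Outside \<open>{1..n}\<close>
  such a \<open>p\<close> is the identity, so pattern occurrences must be restricted to indices in \<open>{1..n}\<close>.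
\<close>

definition avoids_132 :: "nat \<Rightarrow> (nat \<Rightarrow> nat) \<Rightarrow> bool" where
  "avoids_132 n p \<longleftrightarrow>
     \<not> (\<exists>i\<in>{1..n}. \<exists>j\<in>{1..n}. \<exists>k\<in>{1..n}. i < j \<and> j < k \<and> p i < p k \<and> p k < p j)"

end

theory Submission
  imports Defs
begin

text \<open>
  If \<open>n\<close> stands at a position \<open>k\<close> with \<open>2 < k < n\<close>, then \<open>p (k + 1) \<ge> n - 2\<close>. Avoiding 132 forces
  every entry to the left of \<open>n\<close> to exceed \<open>p (k + 1)\<close>, so the two distinct entries \<open>p (k - 2)\<close> and
  \<open>p (k - 1)\<close> would both have to equal \<open>n - 1\<close>.
\<close>

text \<open>If \<open>p i < p k\<close> held, the positions \<open>i < j < k\<close> would form a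
  132 with the maximum \<open>n\<close> as its largest entry; injectivity rules out
  equality.\<close>

lemma avoids_132_left_of_max:
  assumes perm: "p permutes {1..n}" and avoids: "avoids_132 n p"
    and max: "p j = n" and "1 \<le> i" "i < j" "j < k" "k \<le> n"
  shows "p k < p i"
proof -
  have inj: "inj p" using perm by (rule permutes_inj)
  have mem: "i \<in> {1..n}" "j \<in> {1..n}" "k \<in> {1..n}"
    using \<open>1 \<le> i\<close> \<open>i < j\<close> \<open>j < k\<close> \<open>k \<le> n\<close> by simp_all
  have "p k \<le> n" using permutes_in_image[OF perm] mem by auto
  moreover have "p k \<noteq> p j" "p i \<noteq> p k" using \<open>i < j\<close> \<open>j < k\<close> by (simp_all add: inj_eq[OF inj])
  ultimately have "p k < p j" using max by simp
  then have "\<not> p i < p k"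
    using avoids mem \<open>i < j\<close> \<open>j < k\<close> unfolding avoids_132_def by blast
  with \<open>p i \<noteq> p k\<close> show ?thesis by simp
qed

theorem corollary4p1:
  fixes n :: nat and p :: "nat \<Rightarrow> nat"
  assumes "n \<ge> 1"
    and "p permutes {1..n}"
    and "avoids_132 n p"
    and "\<forall>i. 1 \<le> i \<and> i < n \<longrightarrow> \<bar>int (p (i + 1)) - int (p i)\<bar> \<le> 2"
  shows "\<forall>k\<in>{1..n}. p k = n \<longrightarrow> k \<in> {1, 2, n}"
proof (intro ballI impI, rule ccontr)
  fix k assume k: "k \<in> {1..n}" and max: "p k = n" and "k \<notin> {1, 2, n}"
  then have bounds: "2 < k" "k < n" by auto
  have inj: "inj p" using assms(2) by (rule permutes_inj)
  have "\<bar>int (p (k + 1)) - int n\<bar> \<le> 2" using assms(4)[rule_format, of k] bounds max by simp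
  \<comment> \<open>\<open>2 < k\<close> gives \<open>1 \<le> k - 2\<close> despite truncated
    subtraction, and \<open>k < n\<close> gives \<open>k + 1 \<le> n\<close>, so all positions used
    lie in \<open>{1..n}\<close>.\<close>
  moreover have "p (k + 1) < p (k - 1)" "p (k + 1) < p (k - 2)"
    by (rule avoids_132_left_of_max[OF assms(2,3) max]; use bounds in simp)+
  moreover have "p (k - 1) \<le> n" "p (k - 2) \<le> n"
    using permutes_in_image[OF assms(2), of "k - 1"] permutes_in_image[OF assms(2), of "k - 2"]
      bounds by auto
  \<comment> \<open>The first two make the upper bounds by \<open>n\<close> strict; the third denies
    that both entries take the one value left.\<close>
  moreover have "p (k - 1) \<noteq> p k" "p (k - 2) \<noteq> p k" "p (k - 1) \<noteq> p (k - 2)"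
    using bounds by (simp_all add: inj_eq[OF inj])
  ultimately show False using max by linarith
qed

end
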